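(* For every $s\in\mathbb{N}$, if $b$ and $n$ are sufficiently large compared to $s$, then $\operatorname{sn}(S_b\mathbin{\square} H_n)>s$. That is, for every $s\in\mathbb{N}$ there exist $b_0,n_0\in\mathbb{N}$ (depending on $s$) such that $\operatorname{sn}(S_b\mathbin{\square} H_n)>s$ for all integers $b\geqslant b_0$ and $n\geqslant n_0$.
   Context: Graphs are finite, simple and undirected. Let $G$ be a graph and let $\prec$ be a (strict) total order on $V(G)$. Two disjoint edges $vw,xy\in E(G)$ (edges with no common endpoint) with $v\prec w$ and $x\prec y$ \emph{cross} with respect to $\prec$ if $v\prec x\prec w\prec y$ or $x\prec v\prec y\prec w$. For a function $\varphi:E(G)\to\{1,\ldots,k\}$ with $k\in\mathbb{N}$, the pair $(\prec,\varphi)$ is a \emph{$k$-stack layout} of $G$ if $vw$ and $xy$ do not cross for all edges $vw,xy\in E(G)$ with $\varphi(vw)=\varphi(xy)$. The \emph{stack-number} $\operatorname{sn}(G)$ is the smallest integer $s$ for which $G$ has an $s$-stack layout. For graphs $G_1$ and $G_2$, the \emph{cartesian product} $G_1\mathbin{\square}G_2$ is the graph with vertex set $V(G_1)\times V(G_2)$, where $(v_1,v_2)(w_1,w_2)$ is an edge if $v_1=w_1$ and $v_2w_2\in E(G_2)$, or $v_1w_1\in E(G_1)$ and $v_2=w_2$. $S_b$ is the star graph with root $r$ and $b$ leaves. $H_n$ is the triangulated grid graph with vertex set $V(H_n)=\{1,\ldots,n\}^2$ and edge set $$E(H_n)=\{(x,y)(x+1,y):x\in\{1,\ldots,n-1\},\,y\in\{1,\ldots,n\}\}\cup\{(x,y)(x,y+1):x\in\{1,\ldots,n\},\,y\in\{1,\ldots,n-1\}\}\cup\{(x,y)(x+1,y+1):x,y\in\{1,\ldots,n-1\}\}.$$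 *)

theory Defs
  imports Main
begin

text \<open>
  Undirected graphs: an edge is the two-element set of its endpoints, so that an edge
  colouring is automatically a function of the unordered pair.
\<close>

record 'a ugraph =
  gverts :: "'a set"
  gedges :: "'a set set"

definition finite_simple_graph :: "'a ugraph \<Rightarrow> bool" where
  "finite_simple_graph G \<longleftrightarrow>
     finite (gverts G) \<and> (\<forall>e\<in>gedges G. e \<subseteq> gverts G \<and> card e = 2)"

text \<open>A strict total order on the vertex set is given as a relation, \<open>(v, w) \<in> R\<close> meaning
  that \<open>v\<close> precedes \<open>w\<close>.\<close>

definition vertex_ordering :: "'a ugraph \<Rightarrow> 'a rel \<Rightarrow> bool" where
  "vertex_ordering G R \<longleftrightarrow>
     R \<subseteq> gverts G \<times> gverts G \<and> strict_linear_order_on (gverts G) R"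

definition edges_cross :: "'a rel \<Rightarrow> 'a set \<Rightarrow> 'a set \<Rightarrow> bool" where
  "edges_cross R e f \<longleftrightarrow> e \<inter> f = {} \<and>
     (\<exists>v w x y. e = {v, w} \<and> f = {x, y} \<and> (v, w) \<in> R \<and> (x, y) \<in> R \<and>
        ((v, x) \<in> R \<and> (x, w) \<in> R \<and> (w, y) \<in> R \<or>
         (x, v) \<in> R \<and> (v, y) \<in> R \<and> (y, w) \<in> R))"

definition stack_layout :: "nat \<Rightarrow> 'a ugraph \<Rightarrow> 'a rel \<Rightarrow> ('a set \<Rightarrow> nat) \<Rightarrow> bool" where
  "stack_layout k G R \<phi> \<longleftrightarrow>
     vertex_ordering G R \<and> \<phi> ` gedges G \<subseteq> {1..k} \<and>
     (\<forall>e\<in>gedges G. \<forall>f\<in>gedges G. \<phi> e = \<phi> f \<longrightarrow> \<not> edges_cross R e f)"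

text \<open>The minimum is attained for finite simple graphs; see \<open>stack_number_attained\<close> below.\<close>

definition stack_number :: "'a ugraph \<Rightarrow> nat" where
  "stack_number G = (LEAST k. \<exists>R \<phi>. stack_layout k G R \<phi>)"

definition cartesian_graph_product :: "'a ugraph \<Rightarrow> 'b ugraph \<Rightarrow> ('a \<times> 'b) ugraph" where
  "cartesian_graph_product G\<^sub>1 G\<^sub>2 = \<lparr>
     gverts = gverts G\<^sub>1 \<times> gverts G\<^sub>2,
     gedges = {{(v\<^sub>1, v\<^sub>2), (w\<^sub>1, w\<^sub>2)} | v\<^sub>1 v\<^sub>2 w\<^sub>1 w\<^sub>2.
       (v\<^sub>1, v\<^sub>2) \<in> gverts G\<^sub>1 \<times> gverts G\<^sub>2 \<and> (w\<^sub>1, w\<^sub>2) \<in> gverts G\<^sub>1 \<times> gverts G\<^sub>2 \<and>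
       (v\<^sub>1 = w\<^sub>1 \<and> {v\<^sub>2, w\<^sub>2} \<in> gedges G\<^sub>2 \<or> {v\<^sub>1, w\<^sub>1} \<in> gedges G\<^sub>1 \<and> v\<^sub>2 = w\<^sub>2)}\<rparr>"

text \<open>The root is \<open>0\<close> and the leaves are \<open>1, \<dots>, b\<close>.\<close>

definition star_graph :: "nat \<Rightarrow> nat ugraph" where
  "star_graph b = \<lparr>gverts = {0..b}, gedges = {{0, i} | i. i \<in> {1..b}}\<rparr>"

definition triangulated_grid :: "nat \<Rightarrow> (nat \<times> nat) ugraph" where
  "triangulated_grid n = \<lparr>
     gverts = {1..n} \<times> {1..n},
     gedges =
       {{(x, y), (x + 1, y)} | x y. x \<in> {1..<n} \<and> y \<in> {1..n}} \<union>
       {{(x, y), (x, y + 1)} | x y. x \<in> {1..n} \<and> y \<in> {1..<n}} \<union>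
       {{(x, y), (x + 1, y + 1)} | x y. x \<in> {1..<n} \<and> y \<in> {1..<n}}\<rparr>"

lemma finite_simple_graph_star: "finite_simple_graph (star_graph b)"
  by (auto simp: finite_simple_graph_def star_graph_def)

lemma finite_simple_graph_triangulated_grid: "finite_simple_graph (triangulated_grid n)"
  by (auto simp: finite_simple_graph_def triangulated_grid_def)

lemma finite_simple_graph_product:
  assumes "finite_simple_graph G" "finite_simple_graph H"
  shows "finite_simple_graph (cartesian_graph_product G H)"
proof -
  have "v \<noteq> w" if "{v, w} \<in> gedges G" for v w
    using assms(1) that by (auto simp: finite_simple_graph_def)
  moreover have "v \<noteq> w" if "{v, w} \<in> gedges H" for v w
    using assms(2) that by (auto simp: finite_simple_graph_def)
  ultimately show ?thesis
    using assms
    by (auto simp: finite_simple_graph_def cartesian_graph_product_def card_insert_if)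
qed

lemma stack_layout_exists:
  assumes "finite_simple_graph G"
  shows "\<exists>k R \<phi>. stack_layout k G R \<phi>"
proof -
  have sub: "gedges G \<subseteq> Pow (gverts G)"
    using assms by (auto simp: finite_simple_graph_def)
  have "finite (gedges G)"
    using assms finite_subset[OF sub] by (auto simp: finite_simple_graph_def)
  then obtain g :: "'a set \<Rightarrow> nat" and k
    where g: "g ` gedges G = {i. i < k}" "inj_on g (gedges G)"
    using finite_imp_inj_to_nat_seg by metis
  obtain r where "well_order_on (gverts G) r"
    using well_order_on by blast
  then have lin: "strict_linear_order_on (gverts G) (r - Id)"
    using strict_linear_order_on_diff_Id by (auto simp: well_order_on_def)
  define R where "R = (r - Id) \<inter> gverts G \<times> gverts G"
  have "vertex_ordering G R"
    using lin unfolding vertex_ordering_def R_def strict_linear_order_on_def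
      trans_def irrefl_def total_on_def by blast
  moreover have "(\<lambda>e. Suc (g e)) ` gedges G \<subseteq> {1..k}"
    using g(1) by (auto simp: Suc_le_eq)
  moreover have "\<not> edges_cross R e e" for e
    by (auto simp: edges_cross_def)
  ultimately have "stack_layout k G R (\<lambda>e. Suc (g e))"
    using g(2) by (auto simp: stack_layout_def inj_on_def)
  then show ?thesis by blast
qed

lemma stack_number_attained:
  assumes "finite_simple_graph G"
  shows "\<exists>R \<phi>. stack_layout (stack_number G) G R \<phi>"
  unfolding stack_number_def using stack_layout_exists[OF assms] by (rule LeastI_ex)

lemma stack_number_le: "stack_layout k G R \<phi> \<Longrightarrow> stack_number G \<le> k"
  unfolding stack_number_def by (rule Least_le) blast

end

theory Submission
  imports Defs "HOL-Analysis.Brouwer_Fixpoint" "HOL-Library.Ramsey"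
begin

text \<open>
  Suppose there is an \<open>s\<close>-stack layout. By Ramsey's theorem we pass to many leaves for which the
  colour of a copied grid edge does not depend on the leaf, every column of copies of a grid vertex
  \<open>p\<close> is ordered either increasingly or decreasingly, and the root copy of \<open>p\<close> lies on one side of
  its whole column. By the Hex lemma some large connected set \<open>C\<close> of grid vertices has all its
  columns ordered in the same direction. For adjacent \<open>p, q\<close> in \<open>C\<close> the copies of \<open>pq\<close> form a
  monochromatic matching between two columns in the same order, which avoids crossings only if the
  copies are pairwise disjoint intervals; hence copies of \<open>C\<close> at sufficiently distant leaves are
  separated. More than \<open>s\<close> root copies lie on the same side of their columns, and joining these to
  successive separated blocks gives \<open>s + 1\<close> pairwise crossing edges.
\<close>

section \<open>Reversal of the vertex order and basic facts about layouts\<close>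

lemma vertex_ordering_converse: "vertex_ordering G R \<Longrightarrow> vertex_ordering G (R\<inverse>)"
  by (auto simp: vertex_ordering_def strict_linear_order_on_def)

text \<open>Reversing the order swaps the ends of each edge, and the two alternatives in the
  definition of crossing trade places.\<close>

lemma edges_cross_converse: "edges_cross (R\<inverse>) e f \<longleftrightarrow> edges_cross R e f"
proof -
  have imp: "edges_cross R e f" if "edges_cross (R\<inverse>) e f" for R
  proof -
    from that obtain v w x y where
      *: "e \<inter> f = {}" "e = {v, w}" "f = {x, y}" "(v, w) \<in> R\<inverse>" "(x, y) \<in> R\<inverse>"
      "(v, x) \<in> R\<inverse> \<and> (x, w) \<in> R\<inverse> \<and> (w, y) \<in> R\<inverse> \<or>
       (x, v) \<in> R\<inverse> \<and> (v, y) \<in> R\<inverse> \<and> (y, w) \<in> R\<inverse>"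
      unfolding edges_cross_def by (elim conjE exE)
    have "e = {w, v}" "f = {y, x}"
      using *(2,3) by (simp_all only: insert_commute)
    then show ?thesis
      unfolding edges_cross_def using *(1,4-6) unfolding converse_iff
      by (intro conjI exI[of _ w] exI[of _ v] exI[of _ y] exI[of _ x]) argo+
  qed
  show ?thesis
  proof
    show "edges_cross (R\<inverse>) e f \<Longrightarrow> edges_cross R e f" by (rule imp)
    show "edges_cross R e f \<Longrightarrow> edges_cross (R\<inverse>) e f" using imp[of "R\<inverse>"] by simp
  qed
qed

text \<open>Lets root copies that follow their columns be treated as root copies that precede
  them.\<close>

lemma stack_layout_converse: "stack_layout k G R \<phi> \<Longrightarrow> stack_layout k G (R\<inverse>) \<phi>"
  by (simp add: stack_layout_def edges_cross_converse vertex_ordering_converse)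

lemma stack_layout_mono: "stack_layout k G R \<phi> \<Longrightarrow> k \<le> l \<Longrightarrow> stack_layout l G R \<phi>"
proof -
  assume "stack_layout k G R \<phi>" "k \<le> l"
  moreover from this have "{1..k} \<subseteq> {1..l}" by auto
  ultimately show "stack_layout l G R \<phi>" unfolding stack_layout_def by blast
qed

lemma edges_crossI:
  assumes "irrefl R" "trans R" "(v, x) \<in> R" "(x, w) \<in> R" "(w, y) \<in> R"
  shows "edges_cross R {v, w} {x, y}"
proof -
  have "(v, w) \<in> R" "(x, y) \<in> R" "(v, y) \<in> R"
    using assms(2-5) by (meson transD)+
  moreover from this have "{v, w} \<inter> {x, y} = {}"
    using assms(1,3-5) by (auto simp: irrefl_def)
  ultimately show ?thesis
    using assms(3-5) unfolding edges_cross_def by blast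
qed

lemma stack_layoutD:
  assumes "stack_layout k G R \<phi>"
  shows "irrefl R" "trans R"
    and "\<lbrakk>x \<in> gverts G; y \<in> gverts G; x \<noteq> y\<rbrakk> \<Longrightarrow> (x, y) \<in> R \<or> (y, x) \<in> R"
    and "(x, y) \<in> R \<Longrightarrow> x \<in> gverts G \<and> y \<in> gverts G"
    and "e \<in> gedges G \<Longrightarrow> \<phi> e \<in> {1..k}"
    and "\<lbrakk>{v, w} \<in> gedges G; {x, y} \<in> gedges G; \<phi> {v, w} = \<phi> {x, y}; (v, x) \<in> R; (x, w) \<in> R\<rbrakk>
      \<Longrightarrow> (w, y) \<notin> R"
proof -
  show *: "irrefl R" "trans R"
    and "\<lbrakk>x \<in> gverts G; y \<in> gverts G; x \<noteq> y\<rbrakk> \<Longrightarrow> (x, y) \<in> R \<or> (y, x) \<in> R"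
    and "(x, y) \<in> R \<Longrightarrow> x \<in> gverts G \<and> y \<in> gverts G"
    and "e \<in> gedges G \<Longrightarrow> \<phi> e \<in> {1..k}"
    using assms
    by (auto simp: stack_layout_def vertex_ordering_def strict_linear_order_on_def total_on_def)
  show "\<lbrakk>{v, w} \<in> gedges G; {x, y} \<in> gedges G; \<phi> {v, w} = \<phi> {x, y}; (v, x) \<in> R; (x, w) \<in> R\<rbrakk>
      \<Longrightarrow> (w, y) \<notin> R"
    using assms edges_crossI[OF *] unfolding stack_layout_def by blast
qed

section \<open>Separated copies and pairwise crossing edges\<close>

text \<open>Otherwise the order is \<open>(a, q)\<close>, \<open>(b, q)\<close>,
  \<open>(a, p)\<close>, \<open>(b, p)\<close>, and the two copies of the edge \<open>pq\<close>
  cross in one colour.\<close>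

lemma copies_separated_adjacent:
  assumes layout: "stack_layout s G R \<phi>"
    and "a \<noteq> b"
    and edges: "{(a, p), (a, q)} \<in> gedges G" "{(b, p), (b, q)} \<in> gedges G"
      "\<phi> {(a, p), (a, q)} = \<phi> {(b, p), (b, q)}"
    and less: "((a, p), (b, p)) \<in> R" "((a, q), (b, q)) \<in> R"
  shows "((a, p), (b, q)) \<in> R"
proof (rule ccontr)
  assume "\<not> ?thesis"
  then have "((b, q), (a, p)) \<in> R"
    using stack_layoutD(3,4)[OF layout] less assms(2) by blast
  moreover have "{(a, q), (a, p)} \<in> gedges G" "{(b, q), (b, p)} \<in> gedges G"
      "\<phi> {(a, q), (a, p)} = \<phi> {(b, q), (b, p)}"
    using edges by (simp_all add: insert_commute)
  ultimately show False
    using stack_layoutD(6)[OF layout] less by blast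
qed

text \<open>Induction along a walk from \<open>p\<close> to \<open>q\<close>: each edge of the walk
  uses up one leaf index, whence the gap of at least \<open>k\<close>.\<close>

lemma copies_separated:
  assumes layout: "stack_layout s G R \<phi>"
    and inj: "\<And>i j. i < j \<Longrightarrow> j < K \<Longrightarrow> l i \<noteq> l j"
    and edge: "\<And>p q i. (p, q) \<in> E \<Longrightarrow> i < K \<Longrightarrow> {(l i, p), (l i, q)} \<in> gedges G"
    and colour: "\<And>p q i. (p, q) \<in> E \<Longrightarrow> i < K \<Longrightarrow> \<phi> {(l i, p), (l i, q)} = c p q"
    and E: "E \<subseteq> C \<times> C"
    and less: "\<And>p i j. p \<in> C \<Longrightarrow> i < j \<Longrightarrow> j < K \<Longrightarrow> ((l i, p), (l j, p)) \<in> R"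
    and "(p, q) \<in> E ^^ k" "p \<in> C" "i + k \<le> j" "i < j" "j < K"
  shows "((l i, p), (l j, q)) \<in> R"
  using assms(7-)
proof (induction k arbitrary: q j)
  case 0
  then show ?case using less by auto
next
  case (Suc k)
  from Suc.prems(1) obtain r where r: "(p, r) \<in> E ^^ k" "(r, q) \<in> E" by auto
  have step: "((l i', r), (l j, q)) \<in> R" if "i' < j" for i'
  proof -
    have "i' < K" "r \<in> C" "q \<in> C"
      using that \<open>j < K\<close> r(2) E by auto
    then show ?thesis
      using copies_separated_adjacent[OF layout inj[OF that \<open>j < K\<close>]
          edge[OF r(2)] edge[OF r(2)] _ less less] colour[OF r(2)] that \<open>j < K\<close> by simp
  qed
  show ?case
  \<comment> \<open>A gap of one forces \<open>k = 0\<close>, so \<open>r = p\<close> and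
    \<open>step\<close> applies directly. A larger gap is bridged by the copy of \<open>r\<close> at
    index \<open>j - 1\<close>.\<close>
  proof (cases "i = j - 1")
    case True
    with Suc.prems have "k = 0" by simp
    then show ?thesis using r(1) step Suc.prems by auto
  next
    case False
    then have "((l i, p), (l (j - 1), r)) \<in> R"
      using Suc.prems by (intro Suc.IH r) auto
    then show ?thesis
      using step[of "j - 1"] stack_layoutD(2)[OF layout] Suc.prems by (auto dest: transD)
  qed
qed

text \<open>Matching the root vertices, in their order, with increasing blocks of leaf vertices gives
  pairwise crossing edges.\<close>

lemma no_separated_fan:
  assumes layout: "stack_layout s G R \<phi>"
    and P: "card P = Suc s"
    and inj: "inj_on \<rho> P"
    and edge: "\<And>p i. p \<in> P \<Longrightarrow> i \<le> Suc s \<Longrightarrow> {\<rho> p, \<mu> i p} \<in> gedges G"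
    and left: "\<And>p. p \<in> P \<Longrightarrow> (\<rho> p, \<mu> 0 p) \<in> R"
    and sep: "\<And>p q i j. p \<in> P \<Longrightarrow> q \<in> P \<Longrightarrow> i < j \<Longrightarrow> j \<le> Suc s \<Longrightarrow> (\<mu> i p, \<mu> j q) \<in> R"
  shows False
proof -
  note D = stack_layoutD[OF layout]
  have fin: "finite P" using P card.infinite by fastforce
  \<comment> \<open>Numbers \<open>P\<close> in the order of the roots. Counting from 1 keeps block
    0 free, so it lies before every block that is used.\<close>
  define rank where "rank p = Suc (card {q \<in> P. (\<rho> q, \<rho> p) \<in> R})" for p
  have rank_le: "rank p \<le> Suc s" if "p \<in> P" for p
  proof -
    have "{q \<in> P. (\<rho> q, \<rho> p) \<in> R} \<subset> P"
      using that D(1) by (auto simp: irrefl_def)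
    then show ?thesis
      using psubset_card_mono[OF fin] P by (simp add: rank_def Suc_le_eq)
  qed
  have rank_less: "rank p < rank q" if "p \<in> P" "(\<rho> p, \<rho> q) \<in> R" for p q
  proof -
    have "{r \<in> P. (\<rho> r, \<rho> p) \<in> R} \<subset> {r \<in> P. (\<rho> r, \<rho> q) \<in> R}"
      using that D(1,2) by (auto simp: irrefl_def dest: transD)
    then show ?thesis
      using fin by (simp add: rank_def psubset_card_mono)
  qed
  define e where "e p = {\<rho> p, \<mu> (rank p) p}" for p
  have e: "e p \<in> gedges G" if "p \<in> P" for p
    using edge rank_le that by (simp add: e_def)
  \<comment> \<open>Pigeonhole: \<open>Suc s\<close> edges share \<open>s\<close> colours.\<close>
  have "(\<lambda>p. \<phi> (e p)) ` P \<subseteq> {1..s}"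
    using D(5) e by blast
  then have "card ((\<lambda>p. \<phi> (e p)) ` P) \<le> s"
    using card_mono[of "{1..s}"] by fastforce
  then have "\<not> inj_on (\<lambda>p. \<phi> (e p)) P"
    using P by (auto dest: card_image)
  then obtain p q where pq: "p \<in> P" "q \<in> P" "p \<noteq> q" "\<phi> (e p) = \<phi> (e q)"
    by (auto simp: inj_on_def)
  \<comment> \<open>Block 0 serves as a barrier: both roots precede \<open>\<mu> 0 q\<close>, which
    precedes the end of \<open>e p\<close>, which precedes the end of \<open>e q\<close>. So the
    edges cross.\<close>
  have *: False if "p \<in> P" "q \<in> P" "\<phi> (e p) = \<phi> (e q)" "(\<rho> p, \<rho> q) \<in> R" for p q
  proof -
    have "(\<mu> 0 q, \<mu> (rank p) p) \<in> R"
      using sep rank_le that by (simp add: rank_def)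
    then have "(\<rho> q, \<mu> (rank p) p) \<in> R"
      using left[OF \<open>q \<in> P\<close>] D(2) by (auto dest: transD)
    moreover have "(\<mu> (rank p) p, \<mu> (rank q) q) \<in> R"
      using sep rank_le rank_less that by simp
    ultimately show False
      using D(6) e that unfolding e_def by metis
  qed
  have "\<rho> p \<noteq> \<rho> q" using pq inj by (auto dest: inj_onD)
  then have "(\<rho> p, \<rho> q) \<in> R \<or> (\<rho> q, \<rho> p) \<in> R"
    using D(3,4) left pq(1,2) by blast
  then show False using * pq by metis
qed

text \<open>Keeping every \<open>Suc d\<close>-th leaf leaves room for any walk inside
  \<open>C\<close>, so the kept copies are the separated blocks of the fan. The spacing
  \<open>Suc d\<close> rather than \<open>d\<close> keeps the block indices distinct when
  \<open>d = 0\<close>.\<close>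

lemma no_layout_of_ordered_copies:
  assumes layout: "stack_layout s G R \<phi>"
    and inj: "\<And>i j. i < j \<Longrightarrow> j < K \<Longrightarrow> l i \<noteq> l j"
    and edge: "\<And>p q i. (p, q) \<in> E \<Longrightarrow> i < K \<Longrightarrow> {(l i, p), (l i, q)} \<in> gedges G"
    and colour: "\<And>p q i. (p, q) \<in> E \<Longrightarrow> i < K \<Longrightarrow> \<phi> {(l i, p), (l i, q)} = c p q"
    and E: "E \<subseteq> C \<times> C"
    and less: "\<And>p i j. p \<in> C \<Longrightarrow> i < j \<Longrightarrow> j < K \<Longrightarrow> ((l i, p), (l j, p)) \<in> R"
    and reach: "\<And>p q. p \<in> C \<Longrightarrow> q \<in> C \<Longrightarrow> \<exists>k\<le>d. (p, q) \<in> E ^^ k"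
    and root_edge: "\<And>p i. p \<in> C \<Longrightarrow> i < K \<Longrightarrow> {(\<rho>, p), (l i, p)} \<in> gedges G"
    and left: "\<And>p. p \<in> P \<Longrightarrow> ((\<rho>, p), (l 0, p)) \<in> R"
    and P: "P \<subseteq> C" "card P = Suc s"
    and K: "Suc s * Suc d < K"
  shows False
proof (rule no_separated_fan[OF layout P(2), where \<rho> = "\<lambda>p. (\<rho>, p)"
      and \<mu> = "\<lambda>i p. (l (i * Suc d), p)"])
  have bound: "i * Suc d < K" if "i \<le> Suc s" for i
    using mult_le_mono1[OF that, of "Suc d"] K by linarith
  show "inj_on (\<lambda>p. (\<rho>, p)) P" by (simp add: inj_on_def)
  show "{(\<rho>, p), (l (i * Suc d), p)} \<in> gedges G" if "p \<in> P" "i \<le> Suc s" for p i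
    using root_edge bound that P by blast
  show "((\<rho>, p), (l (0 * Suc d), p)) \<in> R" if "p \<in> P" for p
    using left that by simp
  show "((l (i * Suc d), p), (l (j * Suc d), q)) \<in> R"
    if pq: "p \<in> P" "q \<in> P" and ij: "i < j" "j \<le> Suc s" for p q i j
  proof -
    obtain k where k: "k \<le> d" "(p, q) \<in> E ^^ k"
      using reach P pq by blast
    have "Suc i * Suc d \<le> j * Suc d"
      using ij(1) by (intro mult_le_mono1) simp
    then have "i * Suc d + k \<le> j * Suc d" "i * Suc d < j * Suc d"
      using k(1) by simp_all
    then show ?thesis
      using P pq ij(2) bound
      by (intro copies_separated[OF layout inj edge colour E less k(2)]) auto
  qed
qed

section \<open>Ramsey's theorem for pairs\<close>

text \<open>Ramsey's theorem with an arbitrary finite colour set, the homogeneous set being listed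
  in increasing order. The bound precedes \<open>c\<close>, so it cannot depend on a layout.\<close>

lemma ramsey_increasing_sequence:
  fixes D :: "'c set" and K :: nat
  assumes "finite D"
  shows "\<exists>N :: nat. \<forall>b\<ge>N. \<forall>c :: nat \<Rightarrow> nat \<Rightarrow> 'c. (\<forall>u\<in>{1..b}. \<forall>v\<in>{1..b}. u < v \<longrightarrow> c u v \<in> D) \<longrightarrow>
    (\<exists>l d. (\<forall>i<K. l i \<in> {1..b}) \<and> (\<forall>i j. i < j \<longrightarrow> j < K \<longrightarrow> l i < l j \<and> c (l i) (l j) = d))"
proof -
  obtain N :: nat where N: "partn_lst {..<N} (replicate (card D) K) 2"
    using ramsey_full by blast
  obtain h where h: "bij_betw h D {0..<card D}"
    using ex_bij_betw_finite_nat[OF assms] by blast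
  show ?thesis
  proof (intro exI[of _ N] allI impI)
    fix b and c :: "nat \<Rightarrow> nat \<Rightarrow> 'c"
    assume b: "N \<le> b" and c: "\<forall>u\<in>{1..b}. \<forall>v\<in>{1..b}. u < v \<longrightarrow> c u v \<in> D"
    \<comment> \<open>\<open>Min\<close> and \<open>Max\<close> recover the ordered pair from a
      two-element set; \<open>Suc\<close> shifts \<open>{..<N}\<close> to leaves, which start at 1.
      \<open>h\<close> numbers the colours.\<close>
    define f where "f e = h (c (Suc (Min e)) (Suc (Max e)))" for e
    have f_pair: "f {u, v} = h (c (Suc u) (Suc v))" if "u < v" for u v
      using that by (simp add: f_def min_def max_def)
    have "f e \<in> {..<card D}" if e: "e \<in> nsets {..<N} 2" for e
    proof -
      obtain u v where "e = {u, v}" "u < v" "v < N"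
        using e by (auto simp: ordered_nsets_2_eq)
      then show ?thesis
        using c[rule_format, of "Suc u" "Suc v"] b h f_pair by (auto simp: bij_betw_def)
    qed
    then have "f \<in> nsets {..<N} 2 \<rightarrow> {..<card D}" by blast
    from partn_lstE[OF N this] obtain i H where
      H: "H \<in> nsets {..<N} K" and fH: "f ` nsets H 2 \<subseteq> {i}"
      by (metis length_replicate nth_replicate)
    have fin: "finite H" and card: "card H = K" and sub: "H \<subseteq> {..<N}"
      using H by (auto simp: nsets_def)
    define xs where "xs = sorted_list_of_set H"
    have len: "length xs = K" and set: "set xs = H" and sorted: "sorted_wrt (<) xs"
      using fin card by (simp_all add: xs_def)
    define l where "l i = Suc (xs ! i)" for i
    have l: "l i \<in> {1..b}" if "i < K" for i
      using that sub b set len nth_mem[of i xs] by (fastforce simp: l_def)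
    have less: "l i < l j" if "i < j" "j < K" for i j
      using that sorted len by (simp add: l_def sorted_wrt_nth_less)
    have hom: "c (l a) (l b) = inv_into D h i" if "a < b" "b < K" for a b
    proof -
      have "{xs ! a, xs ! b} \<in> nsets H 2"
        using that set len less[OF that] by (auto simp: l_def)
      then have "f {xs ! a, xs ! b} = i"
        using fH by blast
      then have "h (c (l a) (l b)) = i"
        using f_pair less[OF that] by (simp add: l_def)
      moreover have "c (l a) (l b) \<in> D"
        using c l less that by simp
      ultimately show ?thesis
        using h by (metis bij_betw_inv_into_left)
    qed
    show "\<exists>l d. (\<forall>i<K. l i \<in> {1..b}) \<and>
        (\<forall>i j. i < j \<longrightarrow> j < K \<longrightarrow> l i < l j \<and> c (l i) (l j) = d)"
      using l less hom by (intro exI[of _ l] exI[of _ "inv_into D h i"]) simp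
  qed
qed

section \<open>Monochromatic components of the triangulated grid\<close>

text \<open>Merges the three edge types into the relation that holds between vertices of a
  two-dimensional Kuhn simplex.\<close>

lemma triangulated_grid_edgeI:
  assumes "1 \<le> a" "1 \<le> b" "a \<le> a'" "a' \<le> Suc a" "b \<le> b'" "b' \<le> Suc b" "(a, b) \<noteq> (a', b')"
    "a' \<le> n" "b' \<le> n"
  shows "{(a, b), (a', b')} \<in> gedges (triangulated_grid n)"
proof -
  consider "a' = a + 1" "b' = b" | "a' = a" "b' = b + 1" | "a' = a + 1" "b' = b + 1"
    using assms by fastforce
  then show ?thesis
  proof cases
    case 1
    then have "a \<in> {1..<n}" "b \<in> {1..n}" using assms by auto
    then show ?thesis unfolding triangulated_grid_def ugraph.simps 1 by blast
  next
    case 2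
    then have "a \<in> {1..n}" "b \<in> {1..<n}" using assms by auto
    then show ?thesis unfolding triangulated_grid_def ugraph.simps 2 by blast
  next
    case 3
    then have "a \<in> {1..<n}" "b \<in> {1..<n}" using assms by auto
    then show ?thesis unfolding triangulated_grid_def ugraph.simps 3 by blast
  qed
qed

lemma triangulated_grid_edgeD:
  assumes "{x, y} \<in> gedges (triangulated_grid n)"
  shows "x \<in> {1..n} \<times> {1..n}" "y \<in> {1..n} \<times> {1..n}"
    "fst y \<le> Suc (fst x)" "snd y \<le> Suc (snd x)"
proof -
  from assms obtain a b a' b' where e: "{x, y} = {(a, b), (a', b')}"
    and "(a, b) \<in> {1..n} \<times> {1..n}" "(a', b') \<in> {1..n} \<times> {1..n}"
      "a \<le> a'" "a' \<le> a + 1" "b \<le> b'" "b' \<le> b + 1"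
    unfolding triangulated_grid_def ugraph.simps Un_iff
    by (elim disjE CollectE exE conjE) fastforce+
  moreover have "x = (a, b) \<and> y = (a', b') \<or> x = (a', b') \<and> y = (a, b)"
    using e unfolding doubleton_eq_iff .
  ultimately show "x \<in> {1..n} \<times> {1..n}" "y \<in> {1..n} \<times> {1..n}"
    "fst y \<le> Suc (fst x)" "snd y \<le> Suc (snd x)"
    by auto
qed

lemma triangulated_grid_edges_mono:
  assumes "m \<le> n"
  shows "gedges (triangulated_grid m) \<subseteq> gedges (triangulated_grid n)"
proof -
  have "{1..m} \<subseteq> {1..n}" "{1..<m} \<subseteq> {1..<n}" using assms by auto
  then show ?thesis
    unfolding triangulated_grid_def ugraph.simps by (intro Un_mono Collect_mono) blast+
qed

text \<open>A triangle in a two-coloured grid meets at most two monochromatic components, so a labelling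
  by components has no trichromatic triangle. If no component spanned the grid, then
  recording which of the two lower sides a component touches would satisfy the boundary
  conditions of Sperner's lemma.\<close>

lemma spanning_monochromatic_component:
  fixes col :: "nat \<times> nat \<Rightarrow> bool"
  assumes "0 < p"
  defines "E \<equiv> {(x, y). {x, y} \<in> gedges (triangulated_grid (Suc p)) \<and> col x = col y}"
  obtains x y where "(x, y) \<in> E\<^sup>*" "x \<in> {1..Suc p} \<times> {1..Suc p}"
    "fst x = 1 \<and> fst y = Suc p \<or> snd x = 1 \<and> snd y = Suc p"
proof (rule ccontr)
  note spanning = that
  assume "\<not> thesis"
  then have no_span: False if "(x, y) \<in> E\<^sup>*" "x \<in> {1..Suc p} \<times> {1..Suc p}"
    "fst x = 1 \<and> fst y = Suc p \<or> snd x = 1 \<and> snd y = Suc p" for x y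
    using spanning[OF that] by blast
  have symE: "sym (E\<^sup>*)"
    by (intro sym_rtrancl) (auto simp: E_def sym_def insert_commute)
  define side where "side j = (if j = 0 then fst else (snd :: nat \<times> nat \<Rightarrow> nat))" for j :: nat
  \<comment> \<open>Kuhn simplices have coordinates from 0 to \<open>p\<close>, the grid from 1 to
    \<open>Suc p\<close>.\<close>
  define vert where "vert f = (Suc (f 0), Suc (f 1))" for f :: "nat \<Rightarrow> nat"
  define lab where "lab f j = (if \<exists>x. (vert f, x) \<in> E\<^sup>* \<and> x \<in> {1..Suc p} \<times> {1..Suc p} \<and> side j x = 1
    then 0 else 1 :: nat)" for f j
  have "odd (card {s. ksimplex p 2 s \<and> (reduced 2 \<circ> lab) ` s = {..2}})"
  proof (rule kuhn_combinatorial[OF \<open>0 < p\<close>]; intro allI impI; elim conjE)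
    fix f :: "nat \<Rightarrow> nat" and j :: nat
    assume f: "\<forall>j. f j \<le> p" and j: "j < 2"
    have side: "side j (vert f) = Suc (f j)"
      using j by (auto simp: side_def vert_def less_2_cases_iff)
    show "lab f j = 0" if "f j = 0"
    proof -
      have "vert f \<in> {1..Suc p} \<times> {1..Suc p}" "side j (vert f) = 1"
        using f side that by (simp_all add: vert_def)
      then show ?thesis
        unfolding lab_def by (metis (no_types, lifting) rtrancl.rtrancl_refl)
    qed
    \<comment> \<open>A component that meets the upper side here and also the lower side
      \<open>j\<close> would span the grid.\<close>
    show "lab f j = 1" if "f j = p"
    proof -
      have False if "(vert f, x) \<in> E\<^sup>*" "x \<in> {1..Suc p} \<times> {1..Suc p}" "side j x = 1" for x
      proof -
        have "(x, vert f) \<in> E\<^sup>*" using symE that(1) by (auto dest: symD)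
        then show False
          using no_span[OF _ that(2), of "vert f"] that(3) side \<open>f j = p\<close>
          by (cases "j = 0") (auto simp: side_def)
      qed
      then show ?thesis unfolding lab_def by (intro if_not_P) blast
    qed
  qed
  then have "{s. ksimplex p 2 s \<and> (reduced 2 \<circ> lab) ` s = {..2}} \<noteq> {}"
    by (rule odd_card_imp_not_empty)
  \<comment> \<open>\<open>reduced 2\<close> returns the index of the first nonzero label, or 2 if
    both labels are 0. So \<open>s\<close> is a trichromatic triangle.\<close>
  then obtain s base upd where "kuhn_simplex p 2 base upd s"
    and rl: "(reduced 2 \<circ> lab) ` s = {..2}"
    by (auto elim: ksimplex.cases)
  interpret kuhn_simplex p 2 base upd s by fact
  have "card s = 3"
    by (simp add: s_eq card_image inj_enum)
  then have "card ((reduced 2 \<circ> lab) ` s) = card s"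
    unfolding rl by simp
  then have inj: "inj_on (reduced 2 \<circ> lab) s"
    by (rule eq_card_imp_inj_on[rotated]) (simp add: s_eq)
  \<comment> \<open>Two vertices of one colour in the triangle are adjacent, hence in one component,
    hence equally labelled; but the reduced labels are distinct on \<open>s\<close>.\<close>
  have same: False if "i < j" "j \<le> 2" "col (vert (enum i)) = col (vert (enum j))" for i j
  proof -
    have in_s: "enum i \<in> s" "enum j \<in> s" and ne: "enum i \<noteq> enum j"
      using that(1,2) by (auto simp: enum_in enum_inj)
    have le: "enum i t \<le> enum j t" "enum j t \<le> Suc (enum i t)" "enum j t \<le> p" for t
      using that(1,2) enum_mono[of i j] le_Suc_base[OF in_s(2), of t] base_le[OF in_s(1), of t]
        s_le_p[OF in_s(2), of t]
      by (auto simp: le_fun_def)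
    \<comment> \<open>All coordinates from 2 on equal \<open>p\<close>, so distinct vertices already
      differ in the first two.\<close>
    have "(enum i 0, enum i 1) \<noteq> (enum j 0, enum j 1)"
    proof
      assume eq: "(enum i 0, enum i 1) = (enum j 0, enum j 1)"
      have "enum i t = enum j t" for t
      proof (cases "t < 2")
        case True
        then show ?thesis using eq by (auto simp: less_2_cases_iff)
      next
        case False
        then show ?thesis using in_s by (simp add: out_eq_p)
      qed
      with ne show False by blast
    qed
    then have "(vert (enum i), vert (enum j)) \<in> E"
      using le that(3) by (auto simp: E_def vert_def intro!: triangulated_grid_edgeI)
    then have "(vert (enum i), x) \<in> E\<^sup>* \<longleftrightarrow> (vert (enum j), x) \<in> E\<^sup>*" for x
      using symE by (meson r_into_rtrancl rtrancl_trans symD)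
    then have "lab (enum i) = lab (enum j)"
      by (simp add: lab_def fun_eq_iff)
    then have "enum i = enum j"
      using in_s by (intro inj_onD[OF inj]) simp_all
    with ne show False ..
  qed
  show False
    using same[of 0 1] same[of 0 2] same[of 1 2] by auto
qed

text \<open>The step that first brings \<open>f\<close> to \<open>k\<close> or above starts below
  \<open>k\<close> and rises by at most one, so it lands on \<open>k\<close>.\<close>

lemma rtrancl_intermediate_value:
  fixes f :: "'a \<Rightarrow> nat"
  assumes "(x, y) \<in> E\<^sup>*" "\<And>u v. (u, v) \<in> E \<Longrightarrow> f v \<le> Suc (f u)" "f x \<le> k" "k \<le> f y"
  shows "\<exists>z. (x, z) \<in> E\<^sup>* \<and> f z = k"
  using assms(1,4)
proof (induction rule: rtrancl_induct)
  case base
  then show ?case using assms(3) by auto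
next
  case (step y z)
  show ?case
  proof (cases "k \<le> f y")
    case False
    then have "f z = k" using step assms(2)[OF step.hyps(2)] by simp
    moreover have "(x, z) \<in> E\<^sup>*" using step.hyps by (rule rtrancl_into_rtrancl)
    ultimately show ?thesis by blast
  qed (use step in blast)
qed

text \<open>A component joining opposite sides takes all \<open>Suc p\<close> values of one
  coordinate, since an edge raises a coordinate by at most one.\<close>

lemma large_monochromatic_component:
  fixes col :: "nat \<times> nat \<Rightarrow> bool"
  assumes "0 < p"
  defines "E \<equiv> {(x, y). {x, y} \<in> gedges (triangulated_grid (Suc p)) \<and> col x = col y}"
  obtains x where "x \<in> {1..Suc p} \<times> {1..Suc p}" "Suc p \<le> card {y. (x, y) \<in> E\<^sup>*}"
    "{y. (x, y) \<in> E\<^sup>*} \<subseteq> {1..Suc p} \<times> {1..Suc p}"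
proof -
  obtain x y where xy: "(x, y) \<in> E\<^sup>*" "x \<in> {1..Suc p} \<times> {1..Suc p}"
    "fst x = 1 \<and> fst y = Suc p \<or> snd x = 1 \<and> snd y = Suc p"
    using spanning_monochromatic_component[OF assms(1), of col, folded E_def] by blast
  define C where "C = {y. (x, y) \<in> E\<^sup>*}"
  have C: "C \<subseteq> {1..Suc p} \<times> {1..Suc p}"
  proof
    fix z assume "z \<in> C"
    then have "(x, z) \<in> E\<^sup>*" by (simp add: C_def)
    then show "z \<in> {1..Suc p} \<times> {1..Suc p}"
    proof cases
      case base
      then show ?thesis using xy(2) by simp
    next
      case (step w)
      then have "{w, z} \<in> gedges (triangulated_grid (Suc p))" by (simp add: E_def)
      then show ?thesis by (rule triangulated_grid_edgeD(2))
    qed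
  qed
  then have fin: "finite C" by (rule finite_subset) simp
  have step: "fst v \<le> Suc (fst u)" "snd v \<le> Suc (snd u)" if "(u, v) \<in> E" for u v
    using that triangulated_grid_edgeD(3,4)[of u v "Suc p"] by (auto simp: E_def)
  obtain f :: "nat \<times> nat \<Rightarrow> nat" where "{1..Suc p} \<subseteq> f ` C"
  proof (cases "fst x = 1 \<and> fst y = Suc p")
    case True
    then have "{1..Suc p} \<subseteq> fst ` C"
      using rtrancl_intermediate_value[OF xy(1) step(1)] by (force simp: C_def)
    then show thesis by (rule that)
  next
    case False
    then have "{1..Suc p} \<subseteq> snd ` C"
      using rtrancl_intermediate_value[OF xy(1) step(2)] xy(3) by (force simp: C_def)
    then show thesis by (rule that)
  qed
  then have "Suc p \<le> card C"
    using surj_card_le[OF fin, of "{1..Suc p}"] by simp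
  then show thesis
    using that xy(2) C unfolding C_def by blast
qed

section \<open>Edges of the product and the lower bound\<close>

lemma product_edgeI:
  assumes "v \<in> gverts G" "x \<in> gverts H" "y \<in> gverts H" "{x, y} \<in> gedges H"
  shows "{(v, x), (v, y)} \<in> gedges (cartesian_graph_product G H)"
  using assms unfolding cartesian_graph_product_def by auto

lemma product_edgeI2:
  assumes "v \<in> gverts G" "w \<in> gverts G" "x \<in> gverts H" "{v, w} \<in> gedges G"
  shows "{(v, x), (w, x)} \<in> gedges (cartesian_graph_product G H)"
  using assms unfolding cartesian_graph_product_def by auto

theorem theorem2:
  shows "\<forall>s::nat. \<exists>b\<^sub>0 n\<^sub>0 :: nat. \<forall>b\<ge>b\<^sub>0. \<forall>n\<ge>n\<^sub>0.
    stack_number (cartesian_graph_product (star_graph b) (triangulated_grid n)) > s"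
proof
  fix s :: nat
  \<comment> \<open>The component found will have at least \<open>2 * s + 2\<close> vertices, enough
    for \<open>s + 1\<close> root copies on one side. Only this corner of the larger grid is
    used.\<close>
  define m where "m = Suc (2 * s + 1)"
  define V where "V = {1..m} \<times> {1..m}"
  define F where "F = gedges (triangulated_grid m)"
  \<comment> \<open>A bound on walk lengths within the component that depends on \<open>s\<close>
    alone, so that \<open>K\<close> and \<open>N\<close> are fixed before the layout.\<close>
  define d where "d = card (V \<times> V)"
  define K where "K = Suc (Suc s * Suc d)"
  have "finite F"
    by (rule finite_subset[of _ "Pow V"]) (use finite_simple_graph_triangulated_grid[of m] in
      \<open>auto simp: finite_simple_graph_def triangulated_grid_def V_def F_def\<close>)
  then have "finite (Pow V \<times> Pow V \<times> Pow (F \<times> {1..s}))"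
    by (simp add: V_def)
  from ramsey_increasing_sequence[OF this, of "Suc K"] obtain N :: nat where
    N: "\<forall>b\<ge>N. \<forall>c. (\<forall>u\<in>{1..b}. \<forall>v\<in>{1..b}. u < v \<longrightarrow>
          c u v \<in> Pow V \<times> Pow V \<times> Pow (F \<times> {1..s})) \<longrightarrow>
      (\<exists>l d. (\<forall>i<Suc K. l i \<in> {1..b}) \<and>
        (\<forall>i j. i < j \<longrightarrow> j < Suc K \<longrightarrow> l i < l j \<and> c (l i) (l j) = d))" ..
  show "\<exists>b\<^sub>0 n\<^sub>0. \<forall>b\<ge>b\<^sub>0. \<forall>n\<ge>n\<^sub>0.
    s < stack_number (cartesian_graph_product (star_graph b) (triangulated_grid n))"
  proof (intro exI allI impI, rule ccontr)
    fix b n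
    assume b: "N \<le> b" and n: "m \<le> n"
    define G where "G = cartesian_graph_product (star_graph b) (triangulated_grid n)"
    assume "\<not> s < stack_number (cartesian_graph_product (star_graph b) (triangulated_grid n))"
    then have "stack_number G \<le> s" by (simp add: G_def)
    moreover have "finite_simple_graph G"
      unfolding G_def
      by (intro finite_simple_graph_product finite_simple_graph_star
          finite_simple_graph_triangulated_grid)
    ultimately obtain R \<phi> where layout: "stack_layout s G R \<phi>"
      using stack_number_attained stack_layout_mono by metis
    have V_sub: "V \<subseteq> gverts (triangulated_grid n)"
      using n by (auto simp: V_def triangulated_grid_def)
    have F_sub: "F \<subseteq> gedges (triangulated_grid n)"
      using triangulated_grid_edges_mono[OF n] by (simp add: F_def)
    have F_V: "x \<in> V" "y \<in> V" if "{x, y} \<in> F" for x y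
      using triangulated_grid_edgeD[of x y m] that by (simp_all add: F_def V_def)
    have verts: "(v, x) \<in> gverts G" if "v \<le> b" "x \<in> V" for v x
      using that V_sub by (auto simp: G_def cartesian_graph_product_def star_graph_def)
    have copy_edge: "{(v, x), (v, y)} \<in> gedges G" if "v \<le> b" "{x, y} \<in> F" for v x y
      unfolding G_def using that F_V[OF that(2)] F_sub V_sub
      by (intro product_edgeI) (auto simp: star_graph_def)
    have root_edge: "{(0, x), (v, x)} \<in> gedges G" if "v \<in> {1..b}" "x \<in> V" for v x
      unfolding G_def using that V_sub
      by (intro product_edgeI2) (auto simp: star_graph_def)
    \<comment> \<open>The last two components depend on \<open>u\<close> only: homogeneity makes them constant on all leaves of
      the sequence but the last, which is why \<open>Suc K\<close> leaves are requested.\<close>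
    define c where "c u v =
      ({x \<in> V. ((u, x), (v, x)) \<in> R}, {x \<in> V. ((0, x), (u, x)) \<in> R},
       {(e, \<phi> (Pair u ` e)) | e. e \<in> F})" for u v :: nat
    have "\<phi> (Pair u ` e) \<in> {1..s}" if "u \<in> {1..b}" "e \<in> F" for u e
    proof -
      have "card e = 2"
        using finite_simple_graph_triangulated_grid[of m] that(2)
        by (simp add: finite_simple_graph_def F_def)
      then obtain x y where "e = {x, y}" by (auto simp: card_2_iff)
      then show ?thesis
        using stack_layoutD(5)[OF layout copy_edge[of u x y]] that by simp
    qed
    then have "\<forall>u\<in>{1..b}. \<forall>v\<in>{1..b}. u < v \<longrightarrow> c u v \<in> Pow V \<times> Pow V \<times> Pow (F \<times> {1..s})"
      unfolding c_def by blast
    from N[THEN spec, THEN mp, OF b, THEN spec, of c, THEN mp, OF this]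
    obtain l where "\<exists>t. (\<forall>i<Suc K. l i \<in> {1..b}) \<and>
        (\<forall>i j. i < j \<longrightarrow> j < Suc K \<longrightarrow> l i < l j \<and> c (l i) (l j) = t)" ..
    then obtain t where lt: "(\<forall>i<Suc K. l i \<in> {1..b}) \<and>
        (\<forall>i j. i < j \<longrightarrow> j < Suc K \<longrightarrow> l i < l j \<and> c (l i) (l j) = t)" ..
    have l: "l i \<in> {1..b}" if "i < Suc K" for i
      using lt that by blast
    have l_less: "l i < l j" and hom: "c (l i) (l j) = t" if "i < j" "j < Suc K" for i j
      using lt that by blast+
    obtain A B T where t: "t = (A, B, T)" by (cases t) auto
    have A: "((l i, x), (l j, x)) \<in> R \<longleftrightarrow> x \<in> A" if "i < j" "j < K" "x \<in> V" for i j x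
      using hom[of i j] that by (auto simp: c_def t)
    have B: "((0, x), (l i, x)) \<in> R \<longleftrightarrow> x \<in> B" if "i < K" "x \<in> V" for i x
      using hom[of i K] that by (auto simp: c_def t)
    \<comment> \<open>\<open>T\<close> is the graph of the colouring of the copied edges; reading it
      with \<open>THE\<close> gives a colour that does not mention the leaf.\<close>
    have T: "\<phi> {(l i, x), (l i, y)} = (THE k. ({x, y}, k) \<in> T)" if "i < K" "{x, y} \<in> F" for i x y
    proof -
      have "{(e, \<phi> (Pair (l i) ` e)) | e. e \<in> F} = T"
        using hom[of i K] that by (simp add: c_def t)
      then have "({x, y}, k) \<in> T \<longleftrightarrow> k = \<phi> (Pair (l i) ` {x, y})" for k
        using that(2) by blast
      then show ?thesis by simp
    qed
    \<comment> \<open>The grid is two-coloured by the direction of the columns, \<open>A\<close>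
      being the increasing ones.\<close>
    define E where "E = {(x, y). {x, y} \<in> F \<and> (x \<in> A) = (y \<in> A)}"
    obtain z where z: "z \<in> V" "2 * s + 2 \<le> card {y. (z, y) \<in> E\<^sup>*}" "{y. (z, y) \<in> E\<^sup>*} \<subseteq> V"
      using large_monochromatic_component[of "2 * s + 1" "\<lambda>x. x \<in> A"]
      unfolding E_def F_def V_def m_def by auto
    define C where "C = {y. (z, y) \<in> E\<^sup>*}"
    have CV: "C \<subseteq> V" and finC: "finite C"
      using z(3) finite_subset[of C V] by (simp_all add: C_def V_def)
    define E' where "E' = E \<inter> C \<times> C"
    have "E \<subseteq> V \<times> V" using F_V by (auto simp: E_def)
    moreover have "E' \<subseteq> E" by (simp add: E'_def)
    moreover have "finite (V \<times> V)" by (simp add: V_def)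
    ultimately have finE': "finite E'" and cardE': "card E' \<le> d"
      unfolding d_def by (meson card_mono finite_subset subset_trans)+
    \<comment> \<open>Walks from \<open>z\<close> stay in its component, and two vertices joined by
      a walk are joined by one no longer than the number of pairs in \<open>E'\<close>.\<close>
    have reach: "\<exists>k\<le>d. (p, q) \<in> E' ^^ k" if "p \<in> C" "q \<in> C" for p q
    proof -
      have from_z: "(z, y) \<in> E'\<^sup>*" if "(z, y) \<in> E\<^sup>*" for y
        using that
      proof (induction rule: rtrancl_induct)
        case (step y w)
        have "(y, w) \<in> E'"
          using step.hyps rtrancl_into_rtrancl[OF step.hyps] by (simp add: E'_def C_def)
        with step.IH show ?case by (rule rtrancl_into_rtrancl)
      qed simp
      have "sym (E'\<^sup>*)"
        by (intro sym_rtrancl) (auto simp: E'_def E_def sym_def insert_commute)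
      then have "(p, z) \<in> E'\<^sup>*"
        using from_z that(1) by (simp add: C_def symD)
      moreover have "(z, q) \<in> E'\<^sup>*"
        using from_z that(2) by (simp add: C_def)
      ultimately have "(p, q) \<in> E'\<^sup>*" by (rule rtrancl_trans)
      then obtain k where "k \<le> card E'" "(p, q) \<in> E' ^^ k"
        unfolding rtrancl_finite_eq_relpow[OF finE'] by blast
      then show ?thesis using cardE' le_trans by blast
    qed
    have A_const: "x \<in> A \<longleftrightarrow> z \<in> A" if "x \<in> C" for x
    proof -
      have "(z, x) \<in> E\<^sup>*" using that by (simp add: C_def)
      then show ?thesis by induction (auto simp: E_def)
    qed
    have "card (C \<inter> B) + card (C - B) = card C"
      using finC by (metis card_Int_Diff)
    then consider "Suc s \<le> card (C \<inter> B)" | "Suc s \<le> card (C - B)"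
      using z(2) by (fastforce simp: C_def)
    \<comment> \<open>If the majority of root copies lie after their columns, the order is
      reversed.\<close>
    then obtain R' P where layout': "stack_layout s G R' \<phi>" and R': "R' = R \<or> R' = R\<inverse>"
      and P: "P \<subseteq> C" "card P = Suc s"
      and left: "\<And>x i. x \<in> P \<Longrightarrow> i < K \<Longrightarrow> ((0, x), (l i, x)) \<in> R'"
    proof cases
      case 1
      then obtain P where P: "P \<subseteq> C \<inter> B" "card P = Suc s"
        using obtain_subset_with_card_n by metis
      have "((0, x), (l i, x)) \<in> R" if "x \<in> P" "i < K" for x i
        using that P(1) CV B[of i x] by blast
      then show thesis
        using layout P by (intro that[of R P]) auto
    next
      case 2
      then obtain P where P: "P \<subseteq> C - B" "card P = Suc s"
        using obtain_subset_with_card_n by metis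
      have "((0, x), (l i, x)) \<in> R\<inverse>" if "x \<in> P" "i < K" for x i
      proof -
        have "x \<in> V" "x \<notin> B" using that(1) P(1) CV by auto
        moreover have "1 \<le> l i" "l i \<le> b" using l[of i] that(2) by auto
        ultimately show ?thesis
          using stack_layoutD(3)[OF layout verts verts, of 0 x "l i" x] B[OF that(2), of x] by simp
      qed
      then show thesis
        using stack_layout_converse[OF layout] P by (intro that[of "R\<inverse>" P]) auto
    qed
    have dichotomy: "((l i, x), (l j, x)) \<in> R \<longleftrightarrow> z \<in> A" if "x \<in> C" "i < j" "j < K" for x i j
      using A A_const that CV by blast
    have dichotomy': "((l j, x), (l i, x)) \<in> R \<longleftrightarrow> z \<notin> A" if "x \<in> C" "i < j" "j < K" for x i j
    proof -
      have "l i \<le> b" "l j \<le> b" "l i < l j" "x \<in> V"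
        using l[of i] l[of j] l_less that CV by auto
      then have "((l i, x), (l j, x)) \<in> R \<or> ((l j, x), (l i, x)) \<in> R"
        using stack_layoutD(3)[OF layout verts verts, of "l i" x "l j" x] by simp
      moreover have "\<not> (((l i, x), (l j, x)) \<in> R \<and> ((l j, x), (l i, x)) \<in> R)"
        using stack_layoutD(1,2)[OF layout] by (meson irreflD transD)
      ultimately show ?thesis using dichotomy[OF that] by blast
    qed
    \<comment> \<open>Stated for any reindexing \<open>l'\<close>, to cover both the leaf sequence
      and its reversal. This is possible because \<open>left\<close> holds at every leaf.\<close>
    have no_increasing: False
      if l': "\<And>i. i < K \<Longrightarrow> \<exists>i'<K. l' i = l i'" "\<And>i j. i < j \<Longrightarrow> j < K \<Longrightarrow> l' i \<noteq> l' j"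
        and less: "\<And>x i j. x \<in> C \<Longrightarrow> i < j \<Longrightarrow> j < K \<Longrightarrow> ((l' i, x), (l' j, x)) \<in> R'" for l'
    proof (rule no_layout_of_ordered_copies[OF layout', where l = l' and K = K and E = E' and C = C
          and d = d and \<rho> = 0 and P = P and c = "\<lambda>x y. THE k. ({x, y}, k) \<in> T"])
      fix x y i
      assume "(x, y) \<in> E'" "i < K"
      then have "{x, y} \<in> F" by (simp add: E'_def E_def)
      moreover obtain i' where i': "i' < K" "l' i = l i'" using l'(1)[OF \<open>i < K\<close>] by blast
      moreover have "l i' \<le> b" using l[of i'] i' by simp
      ultimately show "{(l' i, x), (l' i, y)} \<in> gedges G"
        "\<phi> {(l' i, x), (l' i, y)} = (THE k. ({x, y}, k) \<in> T)"
        using copy_edge[of "l i'" x y] T[of i' x y] by simp_all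
    next
      fix x
      assume "x \<in> P"
      moreover obtain i' where "i' < K" "l' 0 = l i'" using l'(1)[of 0] by (auto simp: K_def)
      ultimately show "((0, x), (l' 0, x)) \<in> R'" using left[of x i'] by simp
    next
      fix x i
      assume "x \<in> C" "i < K"
      moreover obtain i' where "i' < K" "l' i = l i'" using l'(1)[OF \<open>i < K\<close>] by blast
      ultimately show "{(0, x), (l' i, x)} \<in> gedges G"
        using root_edge[of "l i'" x] l[of i'] CV by auto
    next
      show "E' \<subseteq> C \<times> C" by (simp add: E'_def)
      show "Suc s * Suc d < K" by (simp add: K_def)
    qed (fact l'(2) less reach P)+
    consider
      "\<And>x i j. x \<in> C \<Longrightarrow> i < j \<Longrightarrow> j < K \<Longrightarrow> ((l i, x), (l j, x)) \<in> R'" |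
      "\<And>x i j. x \<in> C \<Longrightarrow> i < j \<Longrightarrow> j < K \<Longrightarrow> ((l j, x), (l i, x)) \<in> R'"
    proof (cases "z \<in> A")
      case True
      from R' show thesis
      proof
        assume "R' = R"
        with dichotomy True show thesis by (intro that(1)) simp
      next
        assume "R' = R\<inverse>"
        with dichotomy True show thesis by (intro that(2)) simp
      qed
    next
      case False
      from R' show thesis
      proof
        assume "R' = R"
        with dichotomy' False show thesis by (intro that(2)) simp
      next
        assume "R' = R\<inverse>"
        with dichotomy' False show thesis by (intro that(1)) simp
      qed
    qed
    then show False
    proof cases
      case 1
      show False
      proof (rule no_increasing[of l])
        show "l i \<noteq> l j" if "i < j" "j < K" for i j
          using l_less[of i j] that by simp
      qed (use 1 in auto)
    next
      case 2
      show False
      \<comment> \<open>Listing the leaves backwards makes the decreasing columns increasing without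
        moving the root copies.\<close>
      proof (rule no_increasing[of "\<lambda>i. l (K - Suc i)"])
        have rev_less: "K - Suc j < K - Suc i" "K - Suc i < K" if "i < j" "j < K" for i j
          using that by linarith+
        show "\<exists>i'<K. l (K - Suc i) = l i'" if "i < K" for i
          using that by (intro exI[of _ "K - Suc i"]) auto
        show "l (K - Suc i) \<noteq> l (K - Suc j)" if "i < j" "j < K" for i j
          using l_less[OF rev_less(1)[OF that]] rev_less(2)[OF that] by simp
        show "((l (K - Suc i), x), (l (K - Suc j), x)) \<in> R'" if "x \<in> C" "i < j" "j < K" for x i j
          using 2[OF that(1) rev_less[OF that(2,3)]] .
      qed
    qed
  qed
qed

end
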